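(* Let $n\ge 1$ be an integer. Any (rational) spectral unit $U$ of size $n$ with finite order is determined by its Fourier coefficient $\xi_0$ together with the Fourier coefficients $\xi_j$ for $j$ ranging over the divisors of $n$ with $1\le j<n$. Moreover, a family of complex numbers consisting of $\xi_0$ and of $\xi_j$ ($j\mid n$, $1\le j<n$) arises in this way from a (rational) spectral unit of size $n$ with finite order if and only if the following conditions hold: (a) $\xi_0=\pm1$; (b) when $n$ is odd: for every divisor $j$ of $n$ with $1\le j<n$, either $\xi_j$ or $-\xi_j$ is a power of $e^{2ij\pi/n}$; (c) when $n$ is even: for every divisor $j$ of $n$ with $1\le j<n$, $\xi_j$ is a power of $e^{2ij\pi/n}$ if $n/j$ is even, and $\xi_j$ is a power of $e^{ij\pi/n}$ if $n/j$ is odd.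
   Context: A matrix $M\in\mathcal M_n(\mathbb C)$, with rows and columns indexed by $\mathbb Z_n=\mathbb Z/n\mathbb Z$, is circulating (circulant) if there is a vector $(\alpha_0,\dots,\alpha_{n-1})$ such that its general coefficient is $m_{i,j}=\alpha_{i-j}$, the index $i-j$ being computed modulo $n$. A (rational) spectral unit of size $n$ is a circulating $n\times n$ matrix $U$ with entries in $\mathbb Q$ which is unitary: ${}^t\overline U=U^{-1}$. It has finite order if $U^m=I_n$ for some integer $m\ge 1$. If $(u_0,\dots,u_{n-1})$ is the first column of $U$, the Fourier coefficients of $U$ are $\xi_j=\sum_{s=0}^{n-1}u_s e^{2ijs\pi/n}$ for $j\in\mathbb Z_n$ (here $i=\sqrt{-1}$ in exponentials); these are the eigenvalues of $U$. "Power" means power with integer exponent. *)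

theory Defs
  imports Complex_Main "Jordan_Normal_Form.Schur_Decomposition"
begin

text \<open>Rows and columns of an \<open>n \<times> n\<close> matrix, and the entries of a vector of size \<open>n\<close>, are indexed
  by the representatives \<open>0, \<dots>, n - 1\<close> of the integers modulo \<open>n\<close>.  The subtraction below takes
  place in \<open>int\<close>, where \<open>mod\<close> has a nonnegative result.\<close>

definition circulant_mat :: "nat \<Rightarrow> complex mat \<Rightarrow> bool" where
  "circulant_mat n M \<longleftrightarrow> M \<in> carrier_mat n n \<and>
     (\<exists>\<alpha> \<in> carrier_vec n. \<forall>i<n. \<forall>j<n. M $$ (i, j) = \<alpha> $ nat ((int i - int j) mod int n))"

text \<open>\<open>mat_adjoint\<close> is the conjugate transpose; it is required to be a two-sided inverse.\<close>

definition unitary_mat :: "nat \<Rightarrow> complex mat \<Rightarrow> bool" where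
  "unitary_mat n U \<longleftrightarrow> U \<in> carrier_mat n n \<and>
     inverts_mat (mat_adjoint U) U \<and> inverts_mat U (mat_adjoint U)"

definition spectral_unit :: "nat \<Rightarrow> complex mat \<Rightarrow> bool" where
  "spectral_unit n U \<longleftrightarrow> circulant_mat n U \<and> elements_mat U \<subseteq> \<rat> \<and> unitary_mat n U"

definition finite_order_mat :: "nat \<Rightarrow> complex mat \<Rightarrow> bool" where
  "finite_order_mat n U \<longleftrightarrow> (\<exists>m\<ge>1. U ^\<^sub>m m = 1\<^sub>m n)"

definition fourier_coeff :: "nat \<Rightarrow> complex mat \<Rightarrow> nat \<Rightarrow> complex" where
  "fourier_coeff n U j =
     (\<Sum>s<n. U $$ (s, 0) * exp (2 * \<i> * of_nat j * of_nat s * of_real pi / of_nat n))"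

definition is_int_power_of :: "complex \<Rightarrow> complex \<Rightarrow> bool" where
  "is_int_power_of x z \<longleftrightarrow> (\<exists>k::int. x = z powi k)"

definition proper_divisors :: "nat \<Rightarrow> nat set" where
  "proper_divisors n = {j. j dvd n \<and> 1 \<le> j \<and> j < n}"

end

theory Submission
  imports Defs "HOL-Number_Theory.Residues"
begin

text \<open>Put \<open>\<zeta> = exp (2\<pi>i/n)\<close>. The Fourier coefficient \<open>\<xi>\<^sub>a\<close> is the value at \<open>\<zeta>^a\<close> of the rational
  polynomial formed from the first column, and \<open>\<zeta>^a\<close> is Galois conjugate to \<open>\<zeta>^j\<close> for
  \<open>j = gcd (a, n)\<close>; hence the \<open>\<xi>\<^sub>j\<close> with \<open>j\<close> dividing \<open>n\<close> determine all the others, and so the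
  matrix. Finite order makes \<open>\<xi>\<^sub>j\<close> a root of unity in the cyclotomic field of order \<open>d = n/j\<close>, which
  leaves \<open>\<xi>\<^sub>j^d = 1\<close>, or \<open>\<xi>\<^sub>j^d = -1\<close> with \<open>d\<close> odd. Conversely, if \<open>\<xi>\<^sub>j = \<plusminus>\<zeta>^(jk)\<close> with sign and \<open>k\<close>
  depending on \<open>j\<close>, put \<open>\<xi>\<^sub>a = \<plusminus>\<zeta>^(ak)\<close> for all \<open>a\<close> with \<open>gcd (a, n) = j\<close>; the entries of the
  circulant matrix with these eigenvalues are rational combinations of Ramanujan sums.

  Galois conjugacy (irreducibility of the cyclotomic polynomials) is obtained by Landau's argument:
  if \<open>P\<close> is an integer polynomial with \<open>P(z) = 0\<close> and \<open>z^N = 1\<close>, then \<open>P(z^p)\<close> is divisible by the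
  prime \<open>p\<close> in \<open>\<int>[z]\<close>. It takes only finitely many values, so it vanishes for large \<open>p\<close>, and every
  residue coprime to \<open>N\<close> is represented by a number all of whose prime factors are large.\<close>

section \<open>Galois conjugates of roots of unity\<close>

lemma prime_dvd_binomial_defect:
  fixes x y :: "'a :: comm_ring_1"
  assumes "prime p"
  shows "of_nat p dvd (x + y) ^ p - x ^ p - y ^ p"
proof -
  have "p > 0" using assms prime_gt_0_nat by blast
  then have "{..p} = insert 0 (insert p {0<..<p})" by auto
  then have "(x + y) ^ p - x ^ p - y ^ p = (\<Sum>k\<in>{0<..<p}. of_nat (p choose k) * x ^ k * y ^ (p - k))"
    using \<open>p > 0\<close> by (simp add: binomial_ring)
  also have "of_nat p dvd \<dots>"
  proof (rule dvd_sum)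
    fix k assume "k \<in> {0<..<p}"
    then have "p dvd p choose k" using assms by (intro dvd_choose_prime) auto
    then show "of_nat p dvd of_nat (p choose k) * x ^ k * y ^ (p - k)"
      by (auto elim!: dvdE)
  qed
  finally show ?thesis .
qed

text \<open>Modulo \<open>p\<close>, taking \<open>p\<close>-th powers is additive and, by Fermat,
  fixes integers, so on polynomials it only replaces X by X^p. At a root \<open>z\<close> of
  \<open>P\<close> this exhibits P(z^p) as \<open>p\<close> times the value at \<open>z\<close> of
  an integer polynomial.\<close>

lemma prime_dvd_poly_frobenius:
  fixes P :: "int poly"
  assumes "prime p"
  shows "of_nat p dvd P \<circ>\<^sub>p Polynomial.monom 1 p - P ^ p"
proof (induction P)
  case 0
  then show ?case using assms prime_gt_0_nat[of p] by (simp add: zero_power)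
next
  case (pCons a P)
  have eq: "pCons a P = [:a:] + [:0, 1:] * P" by simp
  have fermat: "[a ^ p = a] (mod int p)"
  proof -
    define b where "b = nat (a mod int p)"
    have b: "[int b = a] (mod int p)"
      using prime_gt_0_nat[OF assms] by (simp add: b_def cong_def)
    have "[b ^ p = b] (mod p)"
    proof (cases "p dvd b")
      case True
      then have "p dvd b ^ p" using prime_gt_0_nat[OF assms] by (metis dvd_power dvd_trans)
      then show ?thesis using True by (simp add: cong_def mod_0_imp_dvd)
    next
      case False
      then have "[b ^ (p - 1) * b = 1 * b] (mod p)"
        using fermat_theorem[OF assms] cong_scalar_right by blast
      then show ?thesis using prime_gt_0_nat[OF assms] by (metis mult_1 power_minus_mult)
    qed
    then have "[int b ^ p = int b] (mod int p)"
      by (metis cong_int_iff of_nat_power)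
    then show ?thesis using b by (metis cong_pow cong_sym cong_trans)
  qed
  then have 1: "int p dvd a - a ^ p" using fermat by (metis cong_iff_dvd_diff cong_sym)
  have 1: "of_nat p dvd [:a:] - [:a:] ^ p"
  proof -
    from 1 obtain b where "a - a ^ p = int p * b" by (auto elim: dvdE)
    then have "[:a:] - [:a:] ^ p = of_nat p * [:b:]" by (simp add: poly_const_pow of_nat_poly)
    then show ?thesis by (rule dvdI)
  qed
  have 2: "of_nat p dvd Polynomial.monom 1 p * (P \<circ>\<^sub>p Polynomial.monom 1 p - P ^ p)"
    using pCons.IH by simp
  have 3: "of_nat p dvd ([:a:] + [:0, 1:] * P) ^ p - [:a:] ^ p - ([:0, 1:] * P) ^ p"
    by (rule prime_dvd_binomial_defect[OF assms])
  \<comment> \<open>The defect of a + X * P is the defect of \<open>a\<close>, plus X^p times the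
    defect of \<open>P\<close>, minus the binomial defect of the two summands.\<close>
  have "pCons a P \<circ>\<^sub>p Polynomial.monom 1 p - pCons a P ^ p =
      ([:a:] - [:a:] ^ p) + Polynomial.monom 1 p * (P \<circ>\<^sub>p Polynomial.monom 1 p - P ^ p)
      - (([:a:] + [:0, 1:] * P) ^ p - [:a:] ^ p - ([:0, 1:] * P) ^ p)"
    unfolding eq pcompose_add pcompose_mult pcompose_const pcompose_idR power_mult_distrib
    by (simp add: pcompose_pCons monom_altdef algebra_simps)
  then show ?case using 1 2 3 by (metis dvd_add dvd_diff)
qed

section \<open>Divisibility by large primes and conjugate roots\<close>

lemma ex_rat_linear_functional:
  fixes \<alpha> :: complex
  assumes "\<alpha> \<noteq> 0"
  obtains \<phi> :: "complex \<Rightarrow> rat"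
  where "\<And>x y. \<phi> (x + y) = \<phi> x + \<phi> y" "\<phi> \<alpha> \<noteq> 0"
proof -
  interpret vector_space_pair "\<lambda>(q::rat) (x::complex). of_rat q * x" "\<lambda>(q::rat) (x::rat). q * x"
    by unfold_locales (auto simp: algebra_simps of_rat_add of_rat_mult)
  \<comment> \<open>A single nonzero vector is independent over \<rat>, so sending it to 1 extends
    to a linear map on all complex numbers.\<close>
  have "vs1.independent {\<alpha>}" using assms by (simp add: vs1.dependent_single)
  then obtain g where g: "Vector_Spaces.linear (\<lambda>q x. of_rat q * x) (\<lambda>q x. q * x) g" "\<forall>x\<in>{\<alpha>}. g x = 1"
    using linear_independent_extend[of "{\<alpha>}" "\<lambda>_. 1"] by blast
  then interpret l: Vector_Spaces.linear "\<lambda>(q::rat) (x::complex). of_rat q * x" "\<lambda>(q::rat) (x::rat). q * x" g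
    by simp
  show ?thesis using g by (intro that[of g]) (auto simp: l.add)
qed

lemma common_denominator:
  fixes f :: "'a \<Rightarrow> rat"
  assumes "finite A"
  obtains D :: nat where "D > 0" "\<And>x. x \<in> A \<Longrightarrow> of_nat D * f x \<in> \<int>"
proof -
  have "\<exists>D>0. \<forall>x\<in>A. of_nat D * f x \<in> \<int>" using assms
  proof (induction A)
    case empty
    then show ?case by auto
  next
    case (insert a A)
    then obtain D :: nat where D: "D > 0" "\<forall>x\<in>A. of_nat D * f x \<in> \<int>" by blast
    obtain u v where uv: "f a = of_int u / of_int v" "v > 0"
      by (cases "f a") (auto simp: Fract_of_int_quotient)
    have 1: "of_nat (nat v * D) * f a \<in> \<int>"
    proof -
      have "of_nat (nat v * D) * f a = of_int u * of_nat D" using uv by simp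
      then show ?thesis by (metis Ints_mult Ints_of_int Ints_of_nat)
    qed
    have 2: "of_nat (nat v * D) * f x \<in> \<int>" if "x \<in> A" for x
      using D(2) that by (metis Ints_mult Ints_of_nat mult.assoc of_nat_mult)
    show ?case using 1 2 D(1) uv(2) by (intro exI[of _ "nat v * D"]) auto
  qed
  then show ?thesis using that by blast
qed

text \<open>A \<open>\<rat>\<close>-linear functional not vanishing at \<open>\<alpha>\<close> has bounded denominators on the integer
  combinations of \<open>N\<close>-th roots of unity; it takes the place of a norm or an integral basis.\<close>

lemma not_divisible_by_large_multiple:
  fixes \<alpha> :: complex
  assumes "N > 0" "\<alpha> \<noteq> 0"
  obtains A :: nat where
    "\<And>p z R. p > A \<Longrightarrow> z ^ N = 1 \<Longrightarrow> \<alpha> \<noteq> of_nat p * poly (of_int_poly R) z"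
proof -
  obtain \<phi> :: "complex \<Rightarrow> rat"
    where add: "\<And>x y. \<phi> (x + y) = \<phi> x + \<phi> y" and nz: "\<phi> \<alpha> \<noteq> 0"
    using ex_rat_linear_functional[OF assms(2)] by blast
  interpret Modules.additive \<phi> by standard (rule add)
  have phi_nat: "\<phi> (of_nat k * x) = of_nat k * \<phi> x" for k x
    by (induction k) (auto simp: algebra_simps add zero)
  have phi_int: "\<phi> (of_int k * x) = of_int k * \<phi> x" for k x
    by (cases k rule: int_cases2) (auto simp: phi_nat minus)
  \<comment> \<open>Powers of an \<open>N\<close>-th root of unity are again \<open>N\<close>-th
    roots of unity, so one denominator for these finitely many numbers serves every integer
    combination.\<close>
  obtain D :: nat where D: "D > 0" "\<And>x. x ^ N = 1 \<Longrightarrow> of_nat D * \<phi> x \<in> \<int>"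
    using common_denominator[of "{x::complex. x ^ N = 1}" \<phi>] finite_roots_unity[of N] assms(1)
    by (metis (mono_tags, lifting) Suc_leI One_nat_def mem_Collect_eq)
  have int: "of_nat D * \<phi> (poly (of_int_poly R) z) \<in> \<int>" if "z ^ N = 1" for R z
  proof -
    have "poly (of_int_poly R) z = (\<Sum>i\<le>degree R. of_int (poly.coeff R i) * z ^ i)"
      by (simp add: poly_altdef)
    then have "of_nat D * \<phi> (poly (of_int_poly R) z) =
        (\<Sum>i\<le>degree R. of_int (poly.coeff R i) * (of_nat D * \<phi> (z ^ i)))"
      by (simp add: sum phi_int sum_distrib_left mult.left_commute)
    also have "\<dots> \<in> \<int>"
    proof (intro Ints_sum Ints_mult[OF Ints_of_int D(2)])
      fix i show "(z ^ i) ^ N = 1" using that by (metis mult.commute power_mult power_one)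
    qed
    finally show ?thesis .
  qed
  \<comment> \<open>If \<alpha> were \<open>p\<close> times such a combination,
    \<open>of_nat D * \<phi> \<alpha>\<close> would be a nonzero integer multiple of
    \<open>p\<close>, hence at least \<open>p\<close> in absolute value.\<close>
  obtain A :: nat where A: "of_nat D * \<bar>\<phi> \<alpha>\<bar> < of_nat A"
    using reals_Archimedean2 by blast
  show ?thesis
  proof (rule that[of A])
    fix p R and z :: complex assume p: "p > A" and z: "z ^ N = 1"
    show "\<alpha> \<noteq> of_nat p * poly (of_int_poly R) z"
    proof
      assume eq: "\<alpha> = of_nat p * poly (of_int_poly R) z"
      obtain m where m: "of_nat D * \<phi> (poly (of_int_poly R) z) = of_int m"
        using int[OF z] by (auto elim: Ints_cases)
      have "of_nat D * \<phi> \<alpha> = of_nat p * of_int m"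
        using m by (simp add: eq phi_nat)
      then have e: "of_nat D * \<bar>\<phi> \<alpha>\<bar> = of_nat p * of_int \<bar>m\<bar>"
        by (metis abs_mult abs_of_nat of_int_abs)
      have "m \<noteq> 0" using e nz D(1) by auto
      then have "of_nat p * (1::rat) \<le> of_nat p * of_int \<bar>m\<bar>" by (intro mult_left_mono) auto
      then show False using e A p by (metis less_imp_le less_le_trans linorder_not_less mult.right_neutral of_nat_less_iff)
    qed
  qed
qed

text \<open>The bound has to be independent of \<open>z\<close>. Each of the finitely many nonzero
  values of \<open>P\<close> at \<open>N\<close>-th roots of unity has its own bound on the primes
  dividing it, and the sum of these bounds exceeds or equals each of them.\<close>

lemma poly_root_power_large_prime:
  fixes P :: "int poly"
  assumes "N > 0"
  obtains A :: nat where
    "\<And>p z::complex. prime p \<Longrightarrow> p > A \<Longrightarrow> z ^ N = 1 \<Longrightarrow>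
        poly (of_int_poly P) z = 0 \<Longrightarrow>
       poly (of_int_poly P) (z ^ p) = 0"
proof -
  define W where "W = (\<lambda>w. poly (of_int_poly P) w) ` {w::complex. w ^ N = 1} - {0}"
  have "finite W" unfolding W_def using assms finite_roots_unity[of N, where ?'a = complex] by auto
  have "\<exists>A. \<forall>p z R. p > A \<longrightarrow> z ^ N = 1 \<longrightarrow>
      \<alpha> \<noteq> of_nat p * poly (of_int_poly R) z" if "\<alpha> \<in> W" for \<alpha>
    using not_divisible_by_large_multiple[OF assms, of \<alpha>] that unfolding W_def by (metis DiffD2 singletonI)
  then obtain A where A: "\<And>\<alpha> p z R. \<alpha> \<in> W \<Longrightarrow> p > A \<alpha> \<Longrightarrow>
      z ^ N = 1 \<Longrightarrow> \<alpha> \<noteq> of_nat p * poly (of_int_poly R) z"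
    by metis
  show ?thesis
  proof (rule that[of "\<Sum>\<alpha>\<in>W. A \<alpha>"], rule ccontr)
    fix p and z :: complex
    assume p: "prime p" "p > sum A W" and z: "z ^ N = 1" "poly (of_int_poly P) z = 0"
      and nz: "poly (of_int_poly P) (z ^ p) \<noteq> 0"
    have "(z ^ p) ^ N = 1" using z(1) by (metis mult.commute power_mult power_one)
    then have W: "poly (of_int_poly P) (z ^ p) \<in> W" using nz unfolding W_def by auto
    then have "p > A (poly (of_int_poly P) (z ^ p))"
      using p(2) member_le_sum[OF W _ \<open>finite W\<close>, of A] by simp
    moreover obtain R where R: "P \<circ>\<^sub>p Polynomial.monom 1 p - P ^ p = of_nat p * R"
      using prime_dvd_poly_frobenius[OF p(1), of P] by (auto elim: dvdE)
    have "P \<circ>\<^sub>p Polynomial.monom 1 p = P ^ p + of_nat p * R" using R by (simp add: algebra_simps)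
    then have "poly (of_int_poly (P \<circ>\<^sub>p Polynomial.monom 1 p)) z = poly (of_int_poly (P ^ p + of_nat p * R)) z"
      by simp
    then have "poly (of_int_poly P) (z ^ p) = of_nat p * poly (of_int_poly R) z"
      using z(2) prime_gt_0_nat[OF p(1)]
      by (simp add: of_int_poly_hom.hom_add of_int_poly_hom.hom_mult of_int_poly_hom.hom_power of_int_poly_hom.hom_of_nat
           of_int_hom.map_poly_pcompose map_poly_monom poly_pcompose poly_monom zero_power)
    ultimately show False using A[OF W _ z(1)] by blast
  qed
qed

lemma int_poly_root_power_coprime:
  fixes P :: "int poly" and z :: complex
  assumes "N > 0" "z ^ N = 1" "poly (of_int_poly P) z = 0" "coprime k N"
  shows "poly (of_int_poly P) (z ^ k) = 0"
proof -
  obtain A :: nat where A: "\<And>p z::complex. prime p \<Longrightarrow> p > A \<Longrightarrow>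
      z ^ N = 1 \<Longrightarrow> poly (of_int_poly P) z = 0 \<Longrightarrow>
       poly (of_int_poly P) (z ^ p) = 0" using poly_root_power_large_prime[OF assms(1), of P] by blast
  \<comment> \<open>\<open>w\<close> stays arbitrary because removing a prime \<open>p\<close> from
    \<open>l\<close> replaces \<open>w\<close> by \<open>w ^ p\<close>, again an \<open>N\<close>-th
    root of unity and a root of \<open>P\<close>.\<close>
  have large: "poly (of_int_poly P) (w ^ l) = 0"
    if "l > 0" "\<And>p. prime p \<Longrightarrow> p dvd l \<Longrightarrow> p > A" "w ^ N = 1" "poly (of_int_poly P) w = 0" for l and w :: complex
    using that
  proof (induction l arbitrary: w rule: less_induct)
    case (less l)
    show ?case
    proof (cases "l = 1")
      case True
      then show ?thesis using less.prems by simp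
    next
      case False
      then obtain p m where p: "prime p" "l = p * m" by (metis dvdE prime_factor_nat)
      have m: "m > 0" "m < l" using p less.prems(1) prime_gt_1_nat[OF p(1)] by auto
      have w: "(w ^ p) ^ N = 1" by (metis less.prems(3) mult.commute power_mult power_one)
      have 2: "poly (of_int_poly P) (w ^ p) = 0" using A p less.prems by auto
      have "poly (of_int_poly P) ((w ^ p) ^ m) = 0"
        by (rule less.IH[OF m(2) m(1) _ w 2]) (use less.prems(2) p(2) in auto)
      then show ?thesis by (simp add: p(2) power_mult)
    qed
  qed
  \<comment> \<open>each prime up to \<open>A\<close> divides exactly one of \<open>k\<close> and \<open>M\<close>, hence does not divide \<open>k + N * M\<close>\<close>
  define M where "M = \<Prod>{p. prime p \<and> p \<le> A \<and> \<not> p dvd k}"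
  have fin: "finite {p. prime p \<and> p \<le> A \<and> \<not> p dvd k}" by (rule finite_subset[of _ "{..A}"]) auto
  have M: "p dvd M \<longleftrightarrow> \<not> p dvd k" if "prime p" "p \<le> A" for p
  proof
    assume "p dvd M"
    then have "\<exists>q\<in>{p. prime p \<and> p \<le> A \<and> \<not> p dvd k}. p dvd q"
      unfolding M_def using prime_dvd_prod_iff[OF fin that(1), of "\<lambda>x. x"] by simp
    then show "\<not> p dvd k" using that(1) primes_dvd_imp_eq by blast
  next
    assume "\<not> p dvd k"
    then show "p dvd M" unfolding M_def using that fin by (intro dvd_prod_eqI) auto
  qed
  define l where "l = k + N * M"
  \<comment> \<open>This keeps \<open>l\<close> positive even for \<open>k = 0\<close>, which
    coprimality permits when \<open>N = 1\<close>.\<close>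
  have "M > 0" unfolding M_def using fin prime_gt_0_nat by (simp add: prod_pos)
  then have "l > 0" using assms(1) by (simp add: l_def)
  moreover have "p > A" if "prime p" "p dvd l" for p
  proof (rule ccontr)
    assume "\<not> p > A"
    then have "p \<le> A" by simp
    note M = M[OF that(1) this]
    show False
    proof (cases "p dvd k")
      case True
      then have "p dvd N * M" using that(2) unfolding l_def by (simp add: dvd_add_right_iff)
      then have "p dvd N" using M True that(1) prime_dvd_mult_iff by blast
      then show False using True assms(4) that(1) by (metis coprime_common_divisor not_prime_unit)
    next
      case False
      then show False using M that(2) unfolding l_def by (simp add: dvd_add_left_iff)
    qed
  qed
  ultimately have "poly (of_int_poly P) (z ^ l) = 0" using large assms by blast
  moreover have "z ^ l = z ^ k" by (simp add: l_def power_add power_mult assms(2))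
  ultimately show ?thesis by simp
qed

lemma rat_poly_clear_denominators:
  fixes P :: "complex poly"
  assumes "\<And>i. poly.coeff P i \<in> \<rat>"
  obtains D :: int and Q :: "int poly" where "D \<noteq> 0" "Polynomial.smult (of_int D) P = of_int_poly Q"
proof -
  have "\<exists>D Q. (D::int) \<noteq> 0 \<and> Polynomial.smult (of_int D) P = of_int_poly Q" using assms
  proof (induction P)
    case 0
    show ?case by (intro exI[of _ 1] exI[of _ 0]) auto
  next
    case (pCons a P)
    have "poly.coeff P i \<in> \<rat>" for i using pCons.prems[of "Suc i"] by simp
    then obtain D Q where DQ: "D \<noteq> 0" "Polynomial.smult (of_int D) P = of_int_poly Q"
      using pCons.IH by blast
    have "a \<in> \<rat>" using pCons.prems[of 0] by simp
    then obtain u v where uv: "a = of_int u / of_int v" "v > 0" by (metis Rats_cases')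
    have "Polynomial.smult (of_int (v * D)) (pCons a P) = of_int_poly (pCons (u * D) (Polynomial.smult v Q))"
      using uv by (simp add: of_int_hom.map_poly_pCons_hom of_int_hom.map_poly_hom_smult mult.commute flip: DQ(2))
    then show ?case using DQ(1) uv(2) by (metis mult_eq_0_iff less_irrefl)
  qed
  then show ?thesis using that by blast
qed

lemma rat_poly_root_power_coprime:
  fixes P :: "complex poly" and z :: complex
  assumes "\<And>i. poly.coeff P i \<in> \<rat>" "N > 0" "z ^ N = 1" "poly P z = 0" "coprime k N"
  shows "poly P (z ^ k) = 0"
proof -
  obtain D Q where DQ: "D \<noteq> 0" "Polynomial.smult (of_int D) P = of_int_poly Q"
    using rat_poly_clear_denominators[OF assms(1)] by blast
  have "poly (of_int_poly Q) z = 0" using assms(4) by (simp flip: DQ(2))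
  then have "poly (of_int_poly Q) (z ^ k) = 0" using int_poly_root_power_coprime assms by blast
  then show ?thesis using DQ(1) by (simp flip: DQ(2))
qed

section \<open>Powers of a primitive root of unity\<close>

definition zeta :: "nat \<Rightarrow> complex" where "zeta n = cis (2 * pi / n)"

lemma zeta_powi: "zeta n powi k = cis (2 * pi * k / n)"
  by (simp add: zeta_def cis_power_int mult.commute)

lemma zeta_power: "zeta n ^ k = cis (2 * pi * k / n)"
  by (simp add: zeta_def DeMoivre mult.commute)

lemma zeta_nonzero [simp]: "zeta n \<noteq> 0"
  by (simp add: zeta_def)

lemma zeta_power_self [simp]: "n > 0 \<Longrightarrow> zeta n ^ n = 1"
  by (simp add: zeta_power)

lemma exp_eq_zeta_power: "exp (2 * \<i> * of_nat j * of_nat s * of_real pi / of_nat n) = zeta n ^ (j * s)"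
  by (simp add: zeta_power cis_conv_exp algebra_simps)

lemma zeta_power_divisor: "j dvd n \<Longrightarrow> j > 0 \<Longrightarrow> zeta n ^ j = zeta (n div j)"
  unfolding zeta_power by (auto simp: zeta_def elim!: dvdE)

lemma zeta_powi_eq_1_iff:
  assumes "n > 0"
  shows "zeta n powi k = 1 \<longleftrightarrow> int n dvd k"
proof
  assume "zeta n powi k = 1"
  then have "cos (2 * pi * k / n) = 1" unfolding zeta_powi by (metis cis.simps(1) one_complex.simps(1))
  then obtain m where "2 * pi * k / n = of_int m * 2 * pi" by (auto simp: cos_one_2pi_int)
  then have "real_of_int k = real_of_int (m * int n)" using assms by (simp add: field_simps)
  then show "int n dvd k" by (metis dvd_triv_right of_int_eq_iff)
next
  assume "int n dvd k"
  then show "zeta n powi k = 1" using assms by (auto simp: power_int_mult elim!: dvdE)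
qed

lemma zeta_powi_cong:
  assumes "n > 0" "[k = l] (mod int n)"
  shows "zeta n powi k = zeta n powi l"
proof -
  have "zeta n powi (k - l) = 1" using assms zeta_powi_eq_1_iff cong_iff_dvd_diff by blast
  then show ?thesis by (simp add: power_int_diff)
qed

text \<open>Orthogonality of the characters of the integers modulo \<open>n\<close>: a geometric sum
  whose ratio is an \<open>n\<close>-th root of unity.\<close>

lemma sum_zeta_powi:
  assumes "n > 0"
  shows "(\<Sum>a<n. zeta n powi (int a * k)) = (if int n dvd k then of_nat n else 0)"
proof -
  have eq: "zeta n powi (int a * k) = (zeta n powi k) ^ a" for a
    by (simp add: power_int_power' mult.commute)
  have "(zeta n powi k) ^ n = zeta n powi (k * int n)" by (simp add: power_int_power')
  also have "\<dots> = 1" using assms by (simp add: zeta_powi_eq_1_iff)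
  finally have n: "(zeta n powi k) ^ n = 1" .
  show ?thesis
  proof (cases "int n dvd k")
    case True
    then have "zeta n powi k = 1" using assms by (simp add: zeta_powi_eq_1_iff)
    then show ?thesis using True by (simp add: eq)
  next
    case False
    then show ?thesis using assms n by (simp add: eq zeta_powi_eq_1_iff sum_gp_strict)
  qed
qed

lemma root_of_unity_eq_zeta_power:
  assumes "n > 0" "x ^ n = 1"
  obtains k where "x = zeta n ^ k"
proof -
  have "x \<in> (\<lambda>k. cis (2 * pi * real k / real n)) ` {..<n}"
    using bij_betw_imp_surj_on[OF bij_betw_roots_unity[OF assms(1)]] assms(2) by simp
  then show ?thesis using that by (auto simp: zeta_power)
qed

lemma is_int_power_of_zeta_iff:
  assumes "n > 0"
  shows "is_int_power_of x (zeta n) \<longleftrightarrow> x ^ n = 1"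
proof
  assume "is_int_power_of x (zeta n)"
  then obtain k where "x = zeta n powi k" unfolding is_int_power_of_def by blast
  then show "x ^ n = 1" using assms by (simp add: power_int_power' zeta_powi_eq_1_iff)
next
  assume "x ^ n = 1"
  then obtain k where "x = zeta n ^ k" using root_of_unity_eq_zeta_power[OF assms] by blast
  then show "is_int_power_of x (zeta n)" unfolding is_int_power_of_def by (metis power_int_of_nat)
qed

section \<open>Roots of unity in cyclotomic fields\<close>

lemma not_coprime_obtain_prime:
  fixes a b :: nat
  assumes "\<not> coprime a b"
  obtains p where "prime p" "p dvd a" "p dvd b"
proof -
  have "gcd a b \<noteq> 1" using assms coprime_iff_gcd_eq_1 by blast
  then obtain p where "prime p" "p dvd gcd a b" using prime_factor_nat by blast
  then show ?thesis using that by simp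
qed

text \<open>The automorphisms fixing \<open>zeta d\<close> fix the value \<open>\<eta>\<close>. With \<open>c\<close> the order of \<open>\<eta> ^ d\<close>, those given by
  \<open>k = 1 + d * c / p\<close> show that no prime \<open>p\<close> divides both \<open>c\<close> and \<open>d\<close>, and then the one with
  \<open>k = 1\<close> modulo \<open>d\<close> and \<open>k = -1\<close> modulo \<open>c\<close> shows that \<open>\<eta> ^ d\<close> is its own inverse.\<close>

lemma root_of_unity_in_cyclotomic_field:
  fixes P :: "complex poly"
  assumes rat: "\<And>i. poly.coeff P i \<in> \<rat>" and d: "d > 0" and m: "m > 0"
    and root: "poly P (zeta d) ^ m = 1"
  shows "poly P (zeta d) ^ d = 1 \<or> odd d \<and> poly P (zeta d) ^ d = -1"
proof -
  define \<eta> where "\<eta> = poly P (zeta d)"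
  define c where "c = (LEAST c. c > 0 \<and> \<eta> ^ (d * c) = 1)"
  have "m > 0 \<and> \<eta> ^ (d * m) = 1" using m root unfolding \<eta>_def by (metis mult.commute power_mult power_one)
  then have c: "c > 0" "\<eta> ^ (d * c) = 1"
    and c_min: "\<And>c'. c' > 0 \<Longrightarrow> \<eta> ^ (d * c') = 1 \<Longrightarrow> c \<le> c'"
    unfolding c_def by (metis (mono_tags, lifting) LeastI Least_le)+
  then have "\<eta> \<noteq> 0" using d by (auto simp: zero_power)
  have L: "d * c > 0" using c d by simp
  obtain b where b: "\<eta> = zeta (d * c) ^ b" using root_of_unity_eq_zeta_power[OF L c(2)] by blast
  have zc: "zeta (d * c) ^ c = zeta d" using zeta_power_divisor[of c "d * c"] c by simp
  \<comment> \<open>\<open>\<eta> = P(zeta d)\<close> becomes a polynomial relation for \<open>zeta (d * c)\<close>, which its conjugates inherit\<close>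
  define Q where "Q = (\<Sum>i\<le>degree P. Polynomial.monom (poly.coeff P i) (c * i)) - Polynomial.monom 1 b"
  have Q: "poly Q x = poly P (x ^ c) - x ^ b" for x
    by (simp add: Q_def poly_sum poly_monom poly_altdef[of P] power_mult)
  have "poly.coeff Q i \<in> \<rat>" for i
    unfolding Q_def coeff_diff coeff_sum coeff_monom using rat by (intro Rats_diff Rats_sum) auto
  moreover have "poly Q (zeta (d * c)) = 0" by (simp add: Q zc b[symmetric]) (simp add: \<eta>_def)
  ultimately have Qk: "poly Q (zeta (d * c) ^ k) = 0" if "coprime k (d * c)" for k
    using rat_poly_root_power_coprime[OF _ L _ _ that] L by simp
  \<comment> \<open>Replacing \<open>zeta (d * c)\<close> by its \<open>k\<close>-th power fixes
    \<open>zeta d\<close>, because \<open>k\<close> is 1 modulo \<open>d\<close>. The relation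
    \<open>Q\<close> then keeps its value of \<open>P\<close> at \<open>zeta d\<close>, while its
    other term turns from \<eta> into \<open>\<eta> ^ k\<close>.\<close>
  have fixed: "\<eta> ^ k = \<eta>" if "coprime k (d * c)" "[k = 1] (mod d)" for k
  proof -
    have "[int k = 1] (mod int d)" using that(2) by (metis cong_int_iff of_nat_1)
    then have "zeta d powi int k = zeta d powi 1" using zeta_powi_cong[OF d] by blast
    then have k: "zeta d ^ k = zeta d" by simp
    have "(zeta (d * c) ^ k) ^ c = zeta d" using zc k by (metis mult.commute power_mult)
    moreover have "(zeta (d * c) ^ k) ^ b = \<eta> ^ k" using b by (metis mult.commute power_mult)
    ultimately show ?thesis using Qk[OF that(1)] by (simp add: Q \<eta>_def)
  qed
  have cop: "coprime d c"
  proof (rule ccontr)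
    assume "\<not> coprime d c"
    then obtain p where p: "prime p" "p dvd d" "p dvd c"
      by (rule not_coprime_obtain_prime)
    obtain c' where c': "c = p * c'" using p(3) by blast
    have "coprime (1 + d * c') (d * c)"
    proof (rule ccontr)
      assume "\<not> coprime (1 + d * c') (d * c)"
      then obtain q where q: "prime q" "q dvd 1 + d * c'" "q dvd d * c"
        by (rule not_coprime_obtain_prime)
      \<comment> \<open>Since \<open>p\<close> divides \<open>d\<close>, each of the three cases
        makes \<open>q\<close> a divisor of \<open>d * c'\<close>.\<close>
      have "q dvd d \<or> q dvd p \<or> q dvd c'"
        using q(1,3) by (simp add: c' prime_dvd_mult_iff)
      then have "q dvd d * c'" using p(2) by (meson dvd_mult dvd_mult2 dvd_trans)
      then have "q dvd 1" using q(2) by (metis dvd_add_left_iff)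
      then show False using q(1) by simp
    qed
    moreover have "[1 + d * c' = 1] (mod d)" unfolding cong_def by (rule mod_mult_self2)
    ultimately have "\<eta> ^ (1 + d * c') = \<eta>" by (rule fixed)
    then have "\<eta> ^ (d * c') = 1" using \<open>\<eta> \<noteq> 0\<close> by simp
    moreover have "c' > 0" "c' < c" using c(1) c' prime_gt_1_nat[OF p(1)] by auto
    ultimately show False using c_min[of c'] by linarith
  qed
  \<comment> \<open>The residue -1 modulo \<open>c\<close> is represented by the natural number
    \<open>c - 1\<close>, as \<open>c > 0\<close>.\<close>
  obtain k where k: "[k = 1] (mod d)" "[k = c - 1] (mod c)"
    using binary_chinese_remainder_nat[OF cop] by blast
  have k1: "c dvd k + 1"
  proof -
    have "[k + 1 = c - 1 + 1] (mod c)" using k(2) cong_add cong_refl by blast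
    then show ?thesis using c(1) by (simp add: cong_def mod_0_imp_dvd)
  qed
  have "coprime k c"
    using k1 coprime_divisors[of k k c "k + 1"] by simp
  moreover have "coprime k d" using cong_imp_coprime[OF cong_sym[OF k(1)]] by simp
  ultimately have "\<eta> ^ k = \<eta>" using fixed k(1) by simp
  define \<theta> where "\<theta> = \<eta> ^ d"
  have \<theta>c: "\<theta> ^ c = 1" using c(2) by (simp add: \<theta>_def power_mult)
  have "\<theta> ^ k = \<theta>" using \<open>\<eta> ^ k = \<eta>\<close> unfolding \<theta>_def by (metis mult.commute power_mult)
  moreover obtain l where "k + 1 = c * l" using k1 by blast
  then have "\<theta> ^ (k + 1) = 1" using \<theta>c by (simp only: power_mult power_one)
  ultimately have "\<theta> * \<theta> = 1" by simp
  then have \<theta>: "\<theta> = 1 \<or> \<theta> = -1" by (simp add: square_eq_1_iff)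
  \<comment> \<open>For even \<open>d\<close>, coprimality makes \<open>c\<close> odd, and (-1)^c =
    -1 contradicts \<open>\<theta> ^ c = 1\<close>.\<close>
  have "odd d" if "\<theta> = -1"
  proof
    assume "even d"
    then have "odd c" using cop by (metis coprime_common_divisor odd_one)
    then show False using that \<theta>c by simp
  qed
  then show ?thesis using \<theta> unfolding \<theta>_def \<eta>_def by blast
qed

section \<open>Circulant matrices with prescribed eigenvalues\<close>

text \<open>The inverse discrete Fourier transform of \<xi>, spread along the diagonals. The minus
  sign of the inverse transform turns the difference \<open>i - j\<close> into
  \<open>j - i\<close>.\<close>

definition circ :: "nat \<Rightarrow> (nat \<Rightarrow> complex) \<Rightarrow> complex mat" where
  "circ n \<xi> = mat n n (\<lambda>(i, j). (\<Sum>a<n. \<xi> a * zeta n powi (int a * (int j - int i))) / of_nat n)"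

lemma circ_carrier [simp]: "circ n \<xi> \<in> carrier_mat n n"
  and dim_row_circ [simp]: "dim_row (circ n \<xi>) = n"
  and dim_col_circ [simp]: "dim_col (circ n \<xi>) = n"
  by (auto simp: circ_def)

lemma circ_index: "i < n \<Longrightarrow> j < n \<Longrightarrow>
    circ n \<xi> $$ (i, j) = (\<Sum>a<n. \<xi> a * zeta n powi (int a * (int j - int i))) / of_nat n"
  by (simp add: circ_def)

lemma int_dvd_diff_less_iff:
  fixes n a b :: nat
  assumes "a < n" "b < n"
  shows "int n dvd int a - int b \<longleftrightarrow> a = b"
proof -
  have "int n dvd int a - int b \<longleftrightarrow> [a = b] (mod n)" by (simp add: cong_int_iff flip: cong_iff_dvd_diff)
  then show ?thesis using assms by (simp add: cong_def)
qed

lemma circ_one: "n > 0 \<Longrightarrow> circ n (\<lambda>_. 1) = 1\<^sub>m n"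
  by (rule eq_matI) (auto simp: circ_index sum_zeta_powi int_dvd_diff_less_iff)

text \<open>Circulant matrices share the Fourier eigenbasis, so their eigenvalues multiply. In
  coordinates, summing over the inner index \<open>k\<close> leaves only the terms with
  \<open>a = b\<close>, by orthogonality.\<close>

lemma circ_mult:
  assumes "n > 0"
  shows "circ n \<xi> * circ n \<eta> = circ n (\<lambda>a. \<xi> a * \<eta> a)"
proof (rule eq_matI)
  fix i j assume "i < dim_row (circ n (\<lambda>a. \<xi> a * \<eta> a))" "j < dim_col (circ n (\<lambda>a. \<xi> a * \<eta> a))"
  then have ij: "i < n" "j < n" by simp_all
  define e where "e a b = \<xi> a * \<eta> b * zeta n powi (int b * int j - int a * int i)" for a b
  have "(circ n \<xi> * circ n \<eta>) $$ (i, j) = (\<Sum>k<n. circ n \<xi> $$ (i, k) * circ n \<eta> $$ (k, j))"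
    using ij by (simp add: scalar_prod_def lessThan_atLeast0)
  also have "\<dots> = (\<Sum>k<n. \<Sum>a<n. \<Sum>b<n. e a b * zeta n powi (int k * (int a - int b)))
      / (of_nat n * of_nat n)"
    unfolding sum_divide_distrib
  proof (rule sum.cong[OF refl])
    have summand: "(\<xi> a * zeta n powi (int a * (int k - int i))) * (\<eta> b * zeta n powi (int b * (int j - int k)))
        = e a b * zeta n powi (int k * (int a - int b))" for a b k
      by (simp add: e_def flip: power_int_add) (simp add: algebra_simps flip: power_int_add)
    fix k assume "k \<in> {..<n}"
    then have "circ n \<xi> $$ (i, k) * circ n \<eta> $$ (k, j) = (\<Sum>a<n. \<Sum>b<n.
       (\<xi> a * zeta n powi (int a * (int k - int i))) * (\<eta> b * zeta n powi (int b * (int j - int k))))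
       / (of_nat n * of_nat n)"
      using ij by (simp add: circ_index sum_product)
    also have "\<dots> = (\<Sum>a<n. \<Sum>b<n. e a b * zeta n powi (int k * (int a - int b))) / (of_nat n * of_nat n)"
      by (simp only: summand)
    finally show "circ n \<xi> $$ (i, k) * circ n \<eta> $$ (k, j) =
        (\<Sum>a<n. \<Sum>b<n. e a b * zeta n powi (int k * (int a - int b)) / (of_nat n * of_nat n))"
      by (simp add: sum_divide_distrib)
  qed
  also have "(\<Sum>k<n. \<Sum>a<n. \<Sum>b<n. e a b * zeta n powi (int k * (int a - int b))) =
      (\<Sum>a<n. \<Sum>k<n. \<Sum>b<n. e a b * zeta n powi (int k * (int a - int b)))"
    by (rule sum.swap)
  also have "\<dots> = (\<Sum>a<n. \<Sum>b<n. \<Sum>k<n. e a b * zeta n powi (int k * (int a - int b)))"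
    by (rule sum.cong[OF refl]) (rule sum.swap)
  also have "\<dots> = (\<Sum>a<n. \<Sum>b<n. if a = b then e a b * of_nat n else 0)"
    by (intro sum.cong refl)
      (simp add: sum_zeta_powi[OF assms] int_dvd_diff_less_iff flip: sum_distrib_left)
  also have "\<dots> = (\<Sum>a<n. e a a * of_nat n)"
    by (intro sum.cong refl) (simp add: sum.delta)
  also have "\<dots> / (of_nat n * of_nat n) = (\<Sum>a<n. e a a) / of_nat n"
    using assms by (simp flip: sum_distrib_right)
  also have "\<dots> = circ n (\<lambda>a. \<xi> a * \<eta> a) $$ (i, j)"
    using ij by (simp add: circ_index e_def algebra_simps)
  finally show "(circ n \<xi> * circ n \<eta>) $$ (i, j) = circ n (\<lambda>a. \<xi> a * \<eta> a) $$ (i, j)" .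
qed simp_all

lemma circ_power: "n > 0 \<Longrightarrow> circ n \<xi> ^\<^sub>m m = circ n (\<lambda>a. \<xi> a ^ m)"
  by (induction m) (simp_all add: circ_one circ_mult mult.commute)

lemma cnj_zeta_powi: "cnj (zeta n) powi k = zeta n powi (- k)"
  by (simp add: zeta_def cis_cnj cis_power_int)

text \<open>Transposition swaps \<open>i\<close> and \<open>j\<close> and conjugation inverts
  \<open>zeta n\<close>; the two sign changes in the exponent cancel.\<close>

lemma mat_adjoint_circ: "mat_adjoint (circ n \<xi>) = circ n (\<lambda>a. cnj (\<xi> a))"
proof (rule eq_matI)
  fix i j assume "i < dim_row (circ n (\<lambda>a. cnj (\<xi> a)))" "j < dim_col (circ n (\<lambda>a. cnj (\<xi> a)))"
  then have ij: "i < n" "j < n" by simp_all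
  have "mat_adjoint (circ n \<xi>) $$ (i, j) = cnj (circ n \<xi> $$ (j, i))"
    using ij by (simp add: mat_adjoint_def mat_of_rows_index)
  then show "mat_adjoint (circ n \<xi>) $$ (i, j) = circ n (\<lambda>a. cnj (\<xi> a)) $$ (i, j)"
    using ij by (simp add: circ_index cnj_zeta_powi algebra_simps)
qed (simp_all add: mat_adjoint_def)

lemma circulant_mat_circ:
  assumes "n > 0"
  shows "circulant_mat n (circ n \<xi>)"
  unfolding circulant_mat_def
proof (intro conjI bexI allI impI)
  fix i j assume ij: "i < n" "j < n"
  have "zeta n powi (int a * (int j - int i)) = zeta n powi (- int a * ((int i - int j) mod int n))" for a
  proof (rule zeta_powi_cong[OF assms])
    have "[- int a * ((int i - int j) mod int n) = - int a * (int i - int j)] (mod int n)"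
      by (intro cong_mult cong_refl) (simp add: cong_def)
    then show "[int a * (int j - int i) = - int a * ((int i - int j) mod int n)] (mod int n)"
      by (simp add: algebra_simps cong_sym)
  qed
  \<comment> \<open>The vector left open by the introduction rule is instantiated here with the
    first column of \<open>circ n \<xi>\<close>.\<close>
  then show "circ n \<xi> $$ (i, j) = vec n (\<lambda>t. (\<Sum>a<n. \<xi> a * zeta n powi (- int a * int t)) / of_nat n)
       $ nat ((int i - int j) mod int n)"
    using ij assms by (simp add: circ_index nat_less_iff)
qed simp_all

section \<open>Fourier inversion for circulant matrices\<close>

lemma fourier_coeff_alt: "fourier_coeff n U j = (\<Sum>s<n. U $$ (s, 0) * zeta n ^ (j * s))"
  by (simp add: fourier_coeff_def exp_eq_zeta_power)

lemma fourier_coeff_circ: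
  assumes "j < n"
  shows "fourier_coeff n (circ n \<xi>) j = \<xi> j"
proof -
  have n: "n > 0" using assms by simp
  have "fourier_coeff n (circ n \<xi>) j = (\<Sum>s<n. \<Sum>a<n. \<xi> a * zeta n powi (int s * (int j - int a)))
      / of_nat n"
    unfolding fourier_coeff_alt sum_divide_distrib
  proof (rule sum.cong[OF refl])
    have summand: "(\<xi> a * zeta n powi (int a * (int 0 - int s))) * zeta n powi (int (j * s)) =
       \<xi> a * zeta n powi (int s * (int j - int a))" for a s
      by (simp add: algebra_simps del: power_int_of_nat flip: power_int_add)
    fix s assume "s \<in> {..<n}"
    then have "circ n \<xi> $$ (s, 0) * zeta n ^ (j * s) =
       (\<Sum>a<n. (\<xi> a * zeta n powi (int a * (int 0 - int s))) * zeta n powi (int (j * s)) / of_nat n)"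
      using n by (simp add: circ_index sum_divide_distrib sum_distrib_right del: of_nat_mult of_nat_0)
    also have "\<dots> = (\<Sum>a<n. \<xi> a * zeta n powi (int s * (int j - int a)) / of_nat n)"
      by (simp only: summand)
    finally show "circ n \<xi> $$ (s, 0) * zeta n ^ (j * s) =
        (\<Sum>a<n. \<xi> a * zeta n powi (int s * (int j - int a)) / of_nat n)" .
  qed
  also have "(\<Sum>s<n. \<Sum>a<n. \<xi> a * zeta n powi (int s * (int j - int a))) =
      (\<Sum>a<n. \<Sum>s<n. \<xi> a * zeta n powi (int s * (int j - int a)))" by (rule sum.swap)
  also have "\<dots> = (\<Sum>a<n. if j = a then \<xi> a * of_nat n else 0)"
    using assms by (intro sum.cong refl)
      (simp add: sum_zeta_powi[OF n] int_dvd_diff_less_iff flip: sum_distrib_left)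
  also have "\<dots> = \<xi> j * of_nat n" using assms by (simp add: sum.delta)
  finally show ?thesis using n by simp
qed

text \<open>Fourier inversion recovers the first column, and the first column determines a circulant
  matrix: summing over \<open>a\<close> leaves only the row \<open>s = t\<close>, the residue of
  \<open>i - j\<close>.\<close>

lemma circulant_mat_eq_circ:
  assumes "n > 0" "circulant_mat n U"
  shows "U = circ n (fourier_coeff n U)"
proof (rule eq_matI)
  from assms(2) obtain \<alpha> where U: "U \<in> carrier_mat n n"
    and \<alpha>: "\<And>i j. i < n \<Longrightarrow> j < n \<Longrightarrow>
        U $$ (i, j) = \<alpha> $ nat ((int i - int j) mod int n)"
    unfolding circulant_mat_def by blast
  show "dim_row U = dim_row (circ n (fourier_coeff n U))" "dim_col U = dim_col (circ n (fourier_coeff n U))"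
    using U by simp_all
  fix i j assume "i < dim_row (circ n (fourier_coeff n U))" "j < dim_col (circ n (fourier_coeff n U))"
  then have ij: "i < n" "j < n" by simp_all
  define t where "t = nat ((int i - int j) mod int n)"
  have t: "t < n" "[int t = int i - int j] (mod int n)" using assms(1) by (simp_all add: t_def nat_less_iff)
  have dvd: "int n dvd int s + (int j - int i) \<longleftrightarrow> s = t" if "s < n" for s
  proof -
    have "int n dvd int s + (int j - int i) \<longleftrightarrow> [int s = int i - int j] (mod int n)"
      by (simp add: cong_iff_dvd_diff algebra_simps)
    also have "\<dots> \<longleftrightarrow> [int s = int t] (mod int n)" using t(2) by (metis cong_sym cong_trans)
    also have "\<dots> \<longleftrightarrow> s = t"
        using int_dvd_diff_less_iff[OF that t(1)] by (simp add: cong_iff_dvd_diff)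
    finally show ?thesis .
  qed
  have "circ n (fourier_coeff n U) $$ (i, j) =
      (\<Sum>a<n. \<Sum>s<n. U $$ (s, 0) * zeta n powi (int a * (int s + (int j - int i)))) / of_nat n"
    using ij by (simp add: circ_index fourier_coeff_alt sum_distrib_right mult.assoc)
      (simp add: distrib_left power_int_add flip: power_int_of_nat)
  also have "(\<Sum>a<n. \<Sum>s<n. U $$ (s, 0) * zeta n powi (int a * (int s + (int j - int i)))) =
     (\<Sum>s<n. \<Sum>a<n. U $$ (s, 0) * zeta n powi (int a * (int s + (int j - int i))))" by (rule sum.swap)
  also have "\<dots> = (\<Sum>s<n. if s = t then U $$ (s, 0) * of_nat n else 0)"
    by (intro sum.cong refl) (simp add: sum_zeta_powi[OF assms(1)] dvd flip: sum_distrib_left)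
  also have "\<dots> = U $$ (t, 0) * of_nat n" using t by simp
  also have "U $$ (t, 0) = U $$ (i, j)"
    using \<alpha>[of t 0] \<alpha>[OF ij] t(1) assms(1) by (simp add: t_def)
  finally show "U $$ (i, j) = circ n (fourier_coeff n U) $$ (i, j)" using assms(1) by simp
qed

lemma circ_cong: "(\<And>a. a < n \<Longrightarrow> \<xi> a = \<eta> a) \<Longrightarrow> circ n \<xi> = circ n \<eta>"
  by (rule eq_matI) (auto simp: circ_index)

text \<open>Over all multiples of \<open>g\<close> below \<open>n\<close> the sum is a full
  geometric sum, hence rational. Splitting it by \<open>gcd a n\<close> leaves, besides the wanted
  class, the classes of larger multiples of \<open>g\<close>, which downward induction on
  \<open>g\<close> settles.\<close>

lemma ramanujan_sum_rat:
  assumes n: "n > 0" and g: "g dvd n"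
  shows "(\<Sum>a\<in>{a. a < n \<and> gcd a n = g}. zeta n powi (int a * t)) \<in> \<rat>"
  using g
proof (induction "n - g" arbitrary: g rule: less_induct)
  case less
  define f where "f a = zeta n powi (int a * t)" for a
  define S where "S = {a. a < n \<and> g dvd a}"
  define T where "T = {e. e dvd n \<and> g dvd e}"
  have fin: "finite S" "finite T" using n by (auto simp: S_def T_def)
  have "g > 0" using less.prems n by (auto intro: Nat.gr0I)
  have "bij_betw (\<lambda>b. b * g) {..<n div g} S"
    unfolding S_def using \<open>g > 0\<close> less.prems
    by (intro bij_betwI[of _ _ _ "\<lambda>a. a div g"]) (auto simp: less_mult_imp_div_less elim!: dvdE)
  then have "sum f S = (\<Sum>b<n div g. f (b * g))" by (rule sum.reindex_bij_betw[symmetric])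
  also have "\<dots> = (\<Sum>b<n div g. zeta (n div g) powi (int b * t))"
  proof (rule sum.cong[OF refl])
    fix b
    have "f (b * g) = (zeta n ^ g) powi (int b * t)"
      unfolding f_def power_int_power by (simp add: ac_simps)
    then show "f (b * g) = zeta (n div g) powi (int b * t)"
      using zeta_power_divisor[OF less.prems \<open>g > 0\<close>] by simp
  qed
  also have "\<dots> \<in> \<rat>" using less.prems n \<open>g > 0\<close> by (subst sum_zeta_powi) (auto simp: dvd_imp_le)
  finally have S: "sum f S \<in> \<rat>" .
  have inner: "{x \<in> S. gcd x n = e} = {a. a < n \<and> gcd a n = e}" if "e \<in> T" for e
    using that unfolding S_def T_def by auto
  have "sum f S = (\<Sum>e\<in>T. \<Sum>a\<in>{x \<in> S. gcd x n = e}. f a)"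
    using fin less.prems by (intro sum.group[symmetric]) (auto simp: S_def T_def)
  also have "\<dots> = (\<Sum>e\<in>T. \<Sum>a\<in>{a. a < n \<and> gcd a n = e}. f a)"
    by (intro sum.cong refl) (simp add: inner)
  also have "\<dots> = (\<Sum>a\<in>{a. a < n \<and> gcd a n = g}. f a) +
      (\<Sum>e\<in>T - {g}. \<Sum>a\<in>{a. a < n \<and> gcd a n = e}. f a)"
    using less.prems by (intro sum.remove fin) (simp add: T_def)
  finally have "(\<Sum>a\<in>{a. a < n \<and> gcd a n = g}. f a)
      = sum f S - (\<Sum>e\<in>T - {g}. \<Sum>a\<in>{a. a < n \<and> gcd a n = e}. f a)"
    by simp
  moreover have "(\<Sum>e\<in>T - {g}. \<Sum>a\<in>{a. a < n \<and> gcd a n = e}. f a) \<in> \<rat>"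
  proof (rule Rats_sum)
    fix e assume e: "e \<in> T - {g}"
    then have "e dvd n" "g dvd e" "e \<noteq> g" "e > 0" using n by (auto simp: T_def intro: Nat.gr0I)
    then have "g < e" "e \<le> n" using n dvd_imp_le[of g e] dvd_imp_le[of e n] by linarith+
    then show "(\<Sum>a\<in>{a. a < n \<and> gcd a n = e}. f a) \<in> \<rat>"
      unfolding f_def using less.hyps[of e] \<open>e dvd n\<close> by simp
  qed
  ultimately show ?case using S unfolding f_def by simp
qed

text \<open>Where \<open>gcd a n\<close> is constant, so are the factor \<epsilon> and the shift
  \<open>k\<close>; each such class contributes a rational multiple of a Ramanujan sum.\<close>

lemma circ_rat_entries:
  assumes "i < n" "j < n" "\<And>g. \<epsilon> g \<in> \<rat>"
  shows "circ n (\<lambda>a. \<epsilon> (gcd a n) * zeta n ^ (a * k (gcd a n))) $$ (i, j) \<in> \<rat>"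
proof -
  have n: "n > 0" using assms by simp
  define f where "f a g = \<epsilon> g * zeta n powi (int a * (int (k g) + (int j - int i)))" for a g
  have eq: "\<epsilon> g * zeta n ^ (a * k g) * zeta n powi (int a * (int j - int i)) = f a g" for a g
    by (simp add: f_def distrib_left power_int_add flip: power_int_of_nat)
  have "(\<Sum>a<n. f a (gcd a n)) = (\<Sum>g\<in>{g. g dvd n}. \<Sum>a\<in>{a \<in> {..<n}. gcd a n = g}. f a (gcd a n))"
    using n by (intro sum.group[symmetric]) auto
  also have "\<dots> = (\<Sum>g\<in>{g. g dvd n}. \<epsilon> g *
      (\<Sum>a\<in>{a. a < n \<and> gcd a n = g}. zeta n powi (int a * (int (k g) + (int j - int i)))))"
    unfolding sum_distrib_left by (intro sum.cong refl) (auto simp: f_def)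
  also have "\<dots> \<in> \<rat>"
    using Rats_mult[OF assms(3) ramanujan_sum_rat[OF n]] by (intro Rats_sum) simp
  finally have "(\<Sum>a<n. f a (gcd a n)) \<in> \<rat>" .
  then show ?thesis using assms by (simp add: circ_index eq)
qed

section \<open>Fourier coefficients of spectral units\<close>

definition column_poly :: "nat \<Rightarrow> complex mat \<Rightarrow> complex poly" where
  "column_poly n U = (\<Sum>s<n. Polynomial.monom (U $$ (s, 0)) s)"

lemma poly_column_poly: "poly (column_poly n U) (zeta n ^ j) = fourier_coeff n U j"
  by (simp add: column_poly_def fourier_coeff_alt poly_sum poly_monom power_mult)

lemma elements_mat_subset_iff:
  "elements_mat U \<subseteq> A \<longleftrightarrow> (\<forall>i<dim_row U. \<forall>j<dim_col U. U $$ (i, j) \<in> A)"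
  by (auto dest!: elements_matD)

lemma coeff_column_poly_rat:
  assumes "spectral_unit n U"
  shows "poly.coeff (column_poly n U) i \<in> \<rat>"
  using assms unfolding column_poly_def coeff_sum coeff_monom spectral_unit_def circulant_mat_def
    elements_mat_subset_iff by (intro Rats_sum) auto

text \<open>The difference of the two column polynomials is rational and vanishes at
  \<open>zeta n ^ g\<close> for \<open>g = gcd a n\<close>, hence also at the conjugate
  \<open>zeta n ^ a\<close>. So all Fourier coefficients agree, and inversion gives the
  matrices.\<close>

lemma spectral_unit_eqI:
  assumes "n > 0" "spectral_unit n U" "spectral_unit n V"
    and eq: "\<And>j. j \<in> insert 0 (proper_divisors n) \<Longrightarrow> fourier_coeff n U j = fourier_coeff n V j"
  shows "U = V"
proof -
  define P where "P = column_poly n U - column_poly n V"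
  have P: "poly P (zeta n ^ j) = fourier_coeff n U j - fourier_coeff n V j" for j
    by (simp add: P_def poly_column_poly)
  have rat: "poly.coeff P i \<in> \<rat>" for i
    unfolding P_def coeff_diff using assms(2,3) by (intro Rats_diff coeff_column_poly_rat)
  have "fourier_coeff n U a = fourier_coeff n V a" for a
  proof -
    define g where "g = gcd a n"
    have g: "g dvd n" "g > 0" "g dvd a" using assms(1) by (auto simp: g_def)
    have "poly P (zeta n ^ g) = 0"
    proof (cases "g = n")
      case True
      \<comment> \<open>The case \<open>g = n\<close> belongs to the index 0, since
        \<open>zeta n ^ n = 1\<close>.\<close>
      then have "poly P (zeta n ^ g) = poly P (zeta n ^ 0)" using assms(1) by simp
      then show ?thesis unfolding P using eq[of 0] by simp
    next
      case False
      then have "g \<in> proper_divisors n" using g assms(1) dvd_imp_le[of g n] by (simp add: proper_divisors_def)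
      then show ?thesis unfolding P using eq by simp
    qed
    moreover have "(zeta n ^ g) ^ (n div g) = 1"
      using g assms(1) by (simp flip: power_mult)
    moreover have "coprime (a div g) (n div g)"
      using assms(1) unfolding g_def by (intro div_gcd_coprime) simp
    moreover have "n div g > 0" using g assms(1) by (simp add: dvd_imp_le div_greater_zero_iff)
    ultimately have "poly P ((zeta n ^ g) ^ (a div g)) = 0"
      using rat_poly_root_power_coprime[OF rat] by blast
    then have "poly P (zeta n ^ a) = 0" using g by (simp flip: power_mult)
    then show ?thesis unfolding P by simp
  qed
  then have "circ n (fourier_coeff n U) = circ n (fourier_coeff n V)" by (intro circ_cong) simp
  then show ?thesis
    using assms(1-3) circulant_mat_eq_circ unfolding spectral_unit_def by metis
qed

text \<open>The roots of unity in the cyclotomic field of order \<open>d\<close>. For even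
  \<open>d\<close> the number -1 is already a power of \<open>zeta d\<close>; for odd
  \<open>d\<close> the sign has to be allowed separately.\<close>

definition cyclotomic_root_of_unity :: "nat \<Rightarrow> complex \<Rightarrow> bool" where
  "cyclotomic_root_of_unity d x \<longleftrightarrow> x ^ d = 1 \<or> odd d \<and> x ^ d = -1"

lemma cyclotomic_root_of_unity_sign:
  assumes "cyclotomic_root_of_unity d x"
  obtains \<epsilon> where "\<epsilon> = 1 \<or> \<epsilon> = -1" "(\<epsilon> * x) ^ d = 1"
  using assms that[of 1] that[of "-1"] unfolding cyclotomic_root_of_unity_def by auto

text \<open>The Fourier coefficients of a power of \<open>U\<close> are the powers of those of
  \<open>U\<close>, so finite order makes them roots of unity. Leaving \<open>d\<close> free covers
  \<open>j = 0\<close> with \<open>d = 1\<close> as well as \<open>d = n div j\<close>.\<close>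

lemma fourier_coeff_cyclotomic_root_of_unity:
  assumes "n > 0" "spectral_unit n U" "finite_order_mat n U" "j < n"
    and d: "d > 0" "zeta n ^ j = zeta d"
  shows "cyclotomic_root_of_unity d (fourier_coeff n U j)"
proof -
  obtain m where m: "m \<ge> 1" "U ^\<^sub>m m = 1\<^sub>m n" using assms(3) unfolding finite_order_mat_def by blast
  have "circulant_mat n U" using assms(2) unfolding spectral_unit_def by simp
  then have "circ n (\<lambda>a. fourier_coeff n U a ^ m) = circ n (\<lambda>_. 1)"
    using m circulant_mat_eq_circ[OF assms(1)] circ_power[OF assms(1)] circ_one[OF assms(1)] by metis
  then have "fourier_coeff n U j ^ m = 1" using fourier_coeff_circ[OF assms(4)] by metis
  then show ?thesis
    using root_of_unity_in_cyclotomic_field[OF coeff_column_poly_rat[OF assms(2)] d(1), of m] m(1)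
    unfolding d(2)[symmetric] poly_column_poly cyclotomic_root_of_unity_def by simp
qed

lemma ex_spectral_unit:
  assumes n: "n > 0" and \<xi>0: "\<xi> 0 = 1 \<or> \<xi> 0 = -1"
    and \<xi>: "\<And>j. j \<in> proper_divisors n \<Longrightarrow> cyclotomic_root_of_unity (n div j) (\<xi> j)"
  shows "\<exists>U. spectral_unit n U \<and> finite_order_mat n U \<and>
            (\<forall>j \<in> insert 0 (proper_divisors n). fourier_coeff n U j = \<xi> j)"
proof -
  \<comment> \<open>\<open>g mod n\<close> treats the divisor \<open>g = n\<close> as the index \<open>0\<close>\<close>
  have "\<exists>\<epsilon> k. (\<epsilon> = 1 \<or> \<epsilon> = -1) \<and>
      (g dvd n \<longrightarrow> \<xi> (g mod n) = \<epsilon> * zeta n ^ (g * k))" for g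
  proof (cases "g dvd n \<and> g \<noteq> n")
    case False
    \<comment> \<open>For \<open>g = n\<close> the number \<open>\<xi> 0\<close> is itself the sign;
      for a non-divisor \<open>g\<close> it is a mere default that makes the choice total.\<close>
    show ?thesis by (intro exI[of _ "\<xi> 0"] exI[of _ 0]) (use False \<xi>0 in auto)
  next
    case True
    then have g: "g < n" "g > 0" "g \<in> proper_divisors n"
      using n dvd_imp_le[of g n] by (auto simp: proper_divisors_def intro: Nat.gr0I)
    obtain \<epsilon> where \<epsilon>: "\<epsilon> = 1 \<or> \<epsilon> = -1" "(\<epsilon> * \<xi> g) ^ (n div g) = 1"
      using cyclotomic_root_of_unity_sign[OF \<xi>[OF g(3)]] by blast
    have "n div g > 0" using g by (simp add: div_greater_zero_iff)
    then obtain k where "\<epsilon> * \<xi> g = zeta (n div g) ^ k"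
      using root_of_unity_eq_zeta_power \<epsilon>(2) by blast
    then have "\<epsilon> * \<xi> g = zeta n ^ (g * k)"
      using zeta_power_divisor[of g n] True g(2) by (simp add: power_mult)
    moreover have "\<xi> g = \<epsilon> * (\<epsilon> * \<xi> g)" using \<epsilon>(1) by auto
    ultimately have "\<xi> g = \<epsilon> * zeta n ^ (g * k)" by metis
    then show ?thesis using \<epsilon>(1) g(1) by auto
  qed
  then obtain \<epsilon> k where \<epsilon>: "\<And>g. \<epsilon> g = 1 \<or> \<epsilon> g = -1"
    and k: "\<And>g. g dvd n \<Longrightarrow> \<xi> (g mod n) = \<epsilon> g * zeta n ^ (g * k g)" by metis
  \<comment> \<open>Sign and exponent depend on \<open>a\<close> only through
    \<open>gcd a n\<close>, so conjugate roots of unity receive conjugate values; this makes the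
    entries rational.\<close>
  define \<Xi> where "\<Xi> a = \<epsilon> (gcd a n) * zeta n ^ (a * k (gcd a n))" for a
  have \<epsilon>2: "\<epsilon> g * \<epsilon> g = 1" "cnj (\<epsilon> g) = \<epsilon> g" "\<epsilon> g \<in> \<rat>" for g
    using \<epsilon>[of g] by auto
  have unit: "cnj (\<Xi> a) * \<Xi> a = 1" for a
  proof -
    have "cnj (zeta n ^ l) * zeta n ^ l = 1" for l
      by (simp add: zeta_def cis_cnj cis_mult flip: power_mult_distrib)
    moreover have "cnj (\<Xi> a) * \<Xi> a = (\<epsilon> (gcd a n) * \<epsilon> (gcd a n)) *
        (cnj (zeta n ^ (a * k (gcd a n))) * zeta n ^ (a * k (gcd a n)))"
      by (simp only: \<Xi>_def complex_cnj_mult \<epsilon>2(2) ac_simps)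
    ultimately show ?thesis by (simp only: \<epsilon>2(1) mult_1)
  qed
  have rat: "circ n \<Xi> $$ (i, j) \<in> \<rat>" if "i < n" "j < n" for i j
    unfolding \<Xi>_def using circ_rat_entries that \<epsilon>2(3) by blast
  have "unitary_mat n (circ n \<Xi>)"
    using n unit unfolding unitary_mat_def inverts_mat_def mat_adjoint_circ
    by (simp add: circ_mult circ_one mult.commute)
  then have "spectral_unit n (circ n \<Xi>)"
    unfolding spectral_unit_def elements_mat_subset_iff using circulant_mat_circ[OF n] rat by simp
  moreover have "finite_order_mat n (circ n \<Xi>)"
    unfolding finite_order_mat_def
  \<comment> \<open>The factor \<open>n\<close> removes the power of \<open>zeta n\<close>, the
    factor 2 the sign.\<close>
  proof (intro exI[of _ "2 * n"] conjI)
    have "\<Xi> a ^ (2 * n) = 1" for a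
    proof -
      have "\<epsilon> (gcd a n) ^ (2 * n) = 1" using \<epsilon>[of "gcd a n"] by auto
      moreover have "(zeta n ^ b) ^ (2 * n) = 1" for b
      proof -
        have "(zeta n ^ b) ^ (2 * n) = (zeta n ^ n) ^ (2 * b)"
          by (simp only: power_mult[symmetric] ac_simps)
        then show ?thesis using n by simp
      qed
      ultimately show ?thesis by (simp add: \<Xi>_def power_mult_distrib)
    qed
    then show "circ n \<Xi> ^\<^sub>m (2 * n) = 1\<^sub>m n" using n by (simp add: circ_power circ_one)
  qed (use n in simp)
  moreover have "fourier_coeff n (circ n \<Xi>) j = \<xi> j" if "j \<in> insert 0 (proper_divisors n)" for j
  proof -
    have j: "j < n" using that n by (auto simp: proper_divisors_def)
    have "\<Xi> j = \<xi> j"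
    proof (cases "j = 0")
      case True
      \<comment> \<open>\<open>gcd 0 n\<close> is \<open>n\<close>, so index 0 takes its data from
        \<open>g = n\<close>, where the power of \<open>zeta n\<close> is 1.\<close>
      then show ?thesis using k[of n] n by (simp add: \<Xi>_def power_mult)
    next
      case False
      then have "j dvd n" using that by (simp add: proper_divisors_def)
      then show ?thesis using k[of j] j by (simp add: \<Xi>_def gcd_proj1_iff)
    qed
    then show ?thesis using fourier_coeff_circ[OF j] by simp
  qed
  ultimately show ?thesis by blast
qed

text \<open>With \<open>d = n div j\<close> the two exponentials are \<open>zeta d\<close> and
  \<open>zeta (2 * d)\<close>. For odd \<open>n\<close> also \<open>d\<close> is odd, so (-x)^d = 1
  means x^d = -1; and the powers of \<open>zeta (2 * d)\<close> are the \<open>x\<close> whose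
  \<open>d\<close>-th power is 1 or -1.\<close>

lemma cyclotomic_root_of_unity_iff_int_powers:
  assumes "j \<in> proper_divisors n"
  shows "odd n \<Longrightarrow> cyclotomic_root_of_unity (n div j) x \<longleftrightarrow>
      is_int_power_of x (exp (2 * \<i> * of_nat j * of_real pi / of_nat n)) \<or>
      is_int_power_of (- x) (exp (2 * \<i> * of_nat j * of_real pi / of_nat n))"
    and "even n \<Longrightarrow> cyclotomic_root_of_unity (n div j) x \<longleftrightarrow>
      (even (n div j) \<longrightarrow> is_int_power_of x (exp (2 * \<i> * of_nat j * of_real pi / of_nat n))) \<and>
      (odd (n div j) \<longrightarrow> is_int_power_of x (exp (\<i> * of_nat j * of_real pi / of_nat n)))"
proof -
  define d where "d = n div j"
  have j: "j dvd n" "j > 0" "d > 0" and n: "n = j * d"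
    using assms by (auto simp: proper_divisors_def d_def div_greater_zero_iff)
  have 1: "exp (2 * \<i> * of_nat j * of_real pi / of_nat n) = zeta d"
    using exp_eq_zeta_power[of j 1 n] zeta_power_divisor[OF j(1,2)] by (simp add: d_def)
  have 2: "exp (\<i> * of_nat j * of_real pi / of_nat n) = zeta (2 * d)"
    unfolding n zeta_def cis_conv_exp using j(2) by (simp add: field_simps)
  show "cyclotomic_root_of_unity (n div j) x \<longleftrightarrow>
      is_int_power_of x (exp (2 * \<i> * of_nat j * of_real pi / of_nat n)) \<or>
      is_int_power_of (- x) (exp (2 * \<i> * of_nat j * of_real pi / of_nat n))" if "odd n"
  proof -
    have "odd d" using that n by simp
    then show ?thesis
      unfolding 1 is_int_power_of_zeta_iff[OF j(3)] d_def[symmetric] cyclotomic_root_of_unity_def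
      by (auto simp: minus_equation_iff)
  qed
  show "cyclotomic_root_of_unity (n div j) x \<longleftrightarrow>
      (even (n div j) \<longrightarrow> is_int_power_of x (exp (2 * \<i> * of_nat j * of_real pi / of_nat n))) \<and>
      (odd (n div j) \<longrightarrow> is_int_power_of x (exp (\<i> * of_nat j * of_real pi / of_nat n)))"
  proof -
    have "2 * d > 0" using j by simp
    moreover have "x ^ (2 * d) = 1 \<longleftrightarrow> x ^ d = 1 \<or> x ^ d = -1"
      by (simp add: mult.commute[of 2] power_mult power2_eq_1_iff)
    ultimately show ?thesis
      unfolding 1 2 is_int_power_of_zeta_iff[OF j(3)] d_def[symmetric] cyclotomic_root_of_unity_def
      using is_int_power_of_zeta_iff[of "2 * d" x] by auto
  qed
qed

theorem theorem3:
  fixes n :: nat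
  assumes "n \<ge> 1"
  shows "(\<forall>U V. spectral_unit n U \<and> finite_order_mat n U \<and>
            spectral_unit n V \<and> finite_order_mat n V \<and>
            (\<forall>j \<in> insert 0 (proper_divisors n). fourier_coeff n U j = fourier_coeff n V j)
            \<longrightarrow> U = V)
    \<and> (\<forall>\<xi> :: nat \<Rightarrow> complex.
         (\<exists>U. spectral_unit n U \<and> finite_order_mat n U \<and>
            (\<forall>j \<in> insert 0 (proper_divisors n). fourier_coeff n U j = \<xi> j))
         \<longleftrightarrow>
         (\<xi> 0 = 1 \<or> \<xi> 0 = -1)
         \<and> (odd n \<longrightarrow> (\<forall>j \<in> proper_divisors n.
              is_int_power_of (\<xi> j) (exp (2 * \<i> * of_nat j * of_real pi / of_nat n)) \<or>
              is_int_power_of (- \<xi> j) (exp (2 * \<i> * of_nat j * of_real pi / of_nat n))))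
         \<and> (even n \<longrightarrow> (\<forall>j \<in> proper_divisors n.
              (even (n div j) \<longrightarrow>
                 is_int_power_of (\<xi> j) (exp (2 * \<i> * of_nat j * of_real pi / of_nat n))) \<and>
              (odd (n div j) \<longrightarrow>
                 is_int_power_of (\<xi> j) (exp (\<i> * of_nat j * of_real pi / of_nat n))))))"
    (is "?unique \<and> (\<forall>\<xi>. ?arises \<xi> \<longleftrightarrow> ?a \<xi> \<and> ?b \<xi> \<and> ?c \<xi>)")
proof (rule conjI)
  have n: "n > 0" using assms by simp
  show "?unique" using spectral_unit_eqI[OF n] by blast
  show "\<forall>\<xi>. ?arises \<xi> \<longleftrightarrow> ?a \<xi> \<and> ?b \<xi> \<and> ?c \<xi>"
  proof (rule allI)
    fix \<xi> :: "nat \<Rightarrow> complex"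
    have "?b \<xi> \<and> ?c \<xi> \<longleftrightarrow> (\<forall>j \<in> proper_divisors n. cyclotomic_root_of_unity (n div j) (\<xi> j))"
      using cyclotomic_root_of_unity_iff_int_powers[of _ n] by (cases "even n") simp_all
    moreover have "?arises \<xi> \<longleftrightarrow> ?a \<xi> \<and> (\<forall>j \<in> proper_divisors n. cyclotomic_root_of_unity (n div j) (\<xi> j))"
    proof
      assume "?arises \<xi>"
      then obtain U where U: "spectral_unit n U" "finite_order_mat n U"
        and \<xi>: "\<And>j. j \<in> insert 0 (proper_divisors n) \<Longrightarrow> fourier_coeff n U j = \<xi> j" by blast
      \<comment> \<open>Index 0 evaluates at \<open>zeta n ^ 0 = zeta 1\<close>, and for order 1
        only 1 and -1 remain.\<close>
      have "cyclotomic_root_of_unity 1 (\<xi> 0)"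
        using fourier_coeff_cyclotomic_root_of_unity[OF n U n, of 1] \<xi>[of 0] by (simp add: zeta_def)
      moreover have "cyclotomic_root_of_unity (n div j) (\<xi> j)" if "j \<in> proper_divisors n" for j
        using fourier_coeff_cyclotomic_root_of_unity[OF n U, of j "n div j"] \<xi>[of j] that zeta_power_divisor[of j n]
        by (auto simp: proper_divisors_def div_greater_zero_iff)
      ultimately show "?a \<xi> \<and> (\<forall>j \<in> proper_divisors n. cyclotomic_root_of_unity (n div j) (\<xi> j))"
        by (simp add: cyclotomic_root_of_unity_def)
    next
      assume "?a \<xi> \<and> (\<forall>j \<in> proper_divisors n. cyclotomic_root_of_unity (n div j) (\<xi> j))"
      then show "?arises \<xi>" using ex_spectral_unit[OF n] by blast
    qed
    ultimately show "?arises \<xi> \<longleftrightarrow> ?a \<xi> \<and> ?b \<xi> \<and> ?c \<xi>" by blast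
  qed
qed

end
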